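(* Let $f:\mathbb{R}^2\to\mathbb{R}$ be a $C^1$ function and let $K_1,K_2\subset\mathbb{R}$ be Cantor sets (each given by a construction as in the context), where the convex hull of $K_i$ is $[A_i,B_i]$, $i=1,2$. Let $\{G_j^{(i)}\}_j$ denote the gaps of $K_i$ deleted in the first step, and $\{B_j^{(1)}\}_j$ the bridges of $K_1$ in the first step. Suppose that for every $(x,y)\in[A_1,B_1]\times[A_2,B_2]$ (partial derivatives evaluated at $(x,y)$) $$\begin{cases}\partial_xf>0,\ \partial_yf>0,\\ s_{min}(B_2-A_2)\,\partial_yf-\kappa(B_1-A_1)\,\partial_xf\ge0,\\ s_{min}(B_1-A_1)\,\partial_xf-\kappa(B_2-A_2)\,\partial_yf\ge0,\\ (B_2-A_2)\,\partial_yf\ge \partial_xf\cdot\max_j|G_j^{(1)}|,\\ \partial_xf\cdot\min_j|B_j^{(1)}|\ge\partial_yf\cdot\max_j|G_j^{(2)}|.\end{cases}$$ Then $f(K_1,K_2)=\{f(x,y):x\in K_1,\ y\in K_2\}$ is a closed interval.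
   Context: Cantor sets: start with a closed interval $F_0=[A,B]$. In the first step remove $n_1-1$ open intervals from $[A,B]$ so that $n_1\ge 2$ closed intervals remain; $F_1$ is the union of these. Inductively, given $F_k$ (a finite union of closed intervals), from each of its closed intervals remove finitely many (at least one) open intervals so that $m$ closed intervals remain after removing $m-1$ open ones ($m\ge2$ may depend on the interval); $F_{k+1}$ is the union of all remaining closed intervals. The set $K=\bigcap_{k\ge1}F_k$ is called a Cantor set; its convex hull is $[A,B]$. The deleted open intervals are the gaps of $K$, and the closed intervals making up each $F_k$, $k\ge1$, are the bridges of $K$. For a bridge $I$ of $F_k$, $k\ge1$, its father $\hat I$ is the unique interval of $F_{k-1}$ containing $I$. For a gap $G$ deleted in the $k$-th step, $k\ge1$, its father $\hat G$ is the unique interval of $F_{k-1}$ containing $G$. For $K_1,K_2$, write $F_k^{(i)}$ for the $k$-th stage of the construction of $K_i$ (so $F_1^{(i)}$ is the union of the first-step bridges of $K_i$). With $|\cdot|$ denoting length, $$s_{min}=\min_{i=1,2}\inf\{|I|/|\hat I|: I\text{ is a bridge of }K_i\},$$ $$\kappa=\max_{i=1,2}\sup\{|G|/|\hat G|: G\text{ is a gap of }K_i\text{ with }G\subset F_1^{(i)}\}$$ (so first-step gaps are not counted in $\kappa$). *)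

theory Defs
  imports "HOL-Analysis.Analysis"
begin

definition C1 :: "('a::real_normed_vector \<Rightarrow> 'b::real_normed_vector) \<Rightarrow> bool" where
  "C1 f \<longleftrightarrow> (\<exists>f' :: 'a \<Rightarrow> 'a \<Rightarrow>\<^sub>L 'b.
     (\<forall>z. (f has_derivative blinfun_apply (f' z)) (at z)) \<and> continuous_on UNIV f')"

definition partial_x :: "(real \<times> real \<Rightarrow> real) \<Rightarrow> real \<Rightarrow> real \<Rightarrow> real" where
  "partial_x f x y = deriv (\<lambda>t. f (t, y)) x"

definition partial_y :: "(real \<times> real \<Rightarrow> real) \<Rightarrow> real \<Rightarrow> real \<Rightarrow> real" where
  "partial_y f x y = deriv (\<lambda>t. f (x, t)) y"

abbreviation len :: "real set \<Rightarrow> real" where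
  "len \<equiv> measure lborel"

text \<open>Removing the open intervals in \<open>\<G>\<close> from \<open>I\<close> leaves exactly the closed intervals in \<open>\<B>\<close>.
  Remaining intervals are nondegenerate, since further open intervals have to be removed from each
  of them; hence the gaps have no common endpoints with each other or with \<open>I\<close>.\<close>

definition cuts_into :: "real set \<Rightarrow> real set set \<Rightarrow> real set set \<Rightarrow> bool" where
  "cuts_into I \<G> \<B> \<longleftrightarrow>
     finite \<G> \<and> \<G> \<noteq> {} \<and> (\<forall>G\<in>\<G>. \<exists>u v. u < v \<and> G = {u<..<v} \<and> G \<subseteq> I) \<and> disjoint \<G> \<and>
     finite \<B> \<and> (\<forall>J\<in>\<B>. \<exists>c d. c < d \<and> J = {c..d}) \<and> disjoint \<B> \<and>
     card \<B> = card \<G> + 1 \<and> I - \<Union>\<G> = \<Union>\<B>"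

text \<open>\<open>F k\<close> is the collection of closed intervals whose union is the \<open>k\<close>-th stage, and \<open>D k\<close>, for
  \<open>k \<ge> 1\<close>, is the collection of open intervals deleted in the \<open>k\<close>-th step.\<close>

definition cantor_construction ::
  "real \<Rightarrow> real \<Rightarrow> (nat \<Rightarrow> real set set) \<Rightarrow> (nat \<Rightarrow> real set set) \<Rightarrow> bool" where
  "cantor_construction A B F D \<longleftrightarrow>
     A < B \<and> F 0 = {{A..B}} \<and> D 0 = {} \<and>
     (\<forall>k. (\<forall>I\<in>F k. cuts_into I {G\<in>D (Suc k). G \<subseteq> I} {J\<in>F (Suc k). J \<subseteq> I}) \<and>
          (\<forall>G\<in>D (Suc k). \<exists>I\<in>F k. G \<subseteq> I) \<and>
          (\<forall>J\<in>F (Suc k). \<exists>I\<in>F k. J \<subseteq> I))"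

definition cantor_set :: "(nat \<Rightarrow> real set set) \<Rightarrow> real set" where
  "cantor_set F = (\<Inter>k\<in>{1..}. \<Union>(F k))"

text \<open>The father of a bridge of \<open>F k\<close>, or of a gap deleted in the \<open>k\<close>-th step, where \<open>k \<ge> 1\<close>.\<close>

definition father :: "(nat \<Rightarrow> real set set) \<Rightarrow> nat \<Rightarrow> real set \<Rightarrow> real set" where
  "father F k S = (THE J. J \<in> F (k - 1) \<and> S \<subseteq> J)"

definition bridge_ratios :: "(nat \<Rightarrow> real set set) \<Rightarrow> real set" where
  "bridge_ratios F = {len I / len (father F k I) | k I. k \<ge> 1 \<and> I \<in> F k}"

text \<open>The condition \<open>G \<subseteq> \<Union>(F 1)\<close> excludes the gaps deleted in the first step.\<close>

definition gap_ratios :: "(nat \<Rightarrow> real set set) \<Rightarrow> (nat \<Rightarrow> real set set) \<Rightarrow> real set" where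
  "gap_ratios F D = {len G / len (father F k G) | k G. k \<ge> 1 \<and> G \<in> D k \<and> G \<subseteq> \<Union>(F 1)}"

definition s_min :: "(nat \<Rightarrow> real set set) \<Rightarrow> (nat \<Rightarrow> real set set) \<Rightarrow> real" where
  "s_min F1 F2 = min (Inf (bridge_ratios F1)) (Inf (bridge_ratios F2))"

definition kappa :: "(nat \<Rightarrow> real set set) \<Rightarrow> (nat \<Rightarrow> real set set) \<Rightarrow>
    (nat \<Rightarrow> real set set) \<Rightarrow> (nat \<Rightarrow> real set set) \<Rightarrow> real" where
  "kappa F1 D1 F2 D2 = max (Sup (gap_ratios F1 D1)) (Sup (gap_ratios F2 D2))"

end

theory Submission
  imports Defs
begin

text \<open>Write \<open>L\<^sub>1\<close>, \<open>L\<^sub>2\<close> for the lengths of the two hulls. As \<open>f\<close> increases in both variables, a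
  rectangle \<open>I \<times> J\<close> of bridges can only take values between those at its lower left and upper right
  corners. Say that it captures \<open>t\<close> if \<open>t\<close> lies between the two corner values. Split \<open>I\<close> into its
  children. One of the smaller rectangles still captures \<open>t\<close>, provided that no gap \<open>(u, v)\<close> of \<open>I\<close>
  leaves a hole in the range of values, that is, provided \<open>f (v, min J) \<le> f (u, max J)\<close>
  (\<open>bridge_capturing_value\<close>). Along the segment between these two points this follows from
  \<open>(v - u) \<partial>\<^sub>x f \<le> |J| \<partial>\<^sub>y f\<close>. The same holds with the roles of \<open>I\<close> and \<open>J\<close> exchanged.

  Let \<open>a = |I| / L\<^sub>1\<close> and \<open>b = |J| / L\<^sub>2\<close>. For bridges from the first step on, the gaps of \<open>I\<close> have
  length at most \<open>\<kappa> |I|\<close>, so the hypothesis \<open>s L\<^sub>2 \<partial>\<^sub>y f \<ge> \<kappa> L\<^sub>1 \<partial>\<^sub>x f\<close>, with \<open>s = s_min\<close>, permits splitting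
  \<open>I\<close> whenever \<open>b \<ge> s a\<close>, and symmetrically \<open>J\<close> whenever \<open>a \<ge> s b\<close>. Always splitting the relatively
  longer side maintains both inequalities, because a child has at least \<open>s\<close> times the length
  of its father (\<open>captures_step\<close>). The last two hypotheses on \<open>f\<close> serve for the first split of either
  hull (\<open>captures_start\<close>).

  Second-step gaps make \<open>\<kappa>\<close> positive, and then the hypotheses force \<open>s > 0\<close>. Each split removes at
  least the proportion \<open>s\<close>, the share of a sibling, from one side. So the areas tend to zero, and
  both sides with them, since they stay comparable. The corners of the rectangles
  belong to the product of the Cantor sets. Hence every \<open>t\<close> between \<open>f (A\<^sub>1, A\<^sub>2)\<close> and \<open>f (B\<^sub>1, B\<^sub>2)\<close> is a
  limit of values of \<open>f\<close> on that product, and by compactness is itself such a value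
  (\<open>image_cantor_sets\<close>).\<close>

section \<open>Cutting a single interval\<close>

lemma len_Icc [simp]: "c \<le> d \<Longrightarrow> len {c..d} = d - c" for c d :: real
  by simp

lemma len_Ioo [simp]: "c \<le> d \<Longrightarrow> len {c<..<d} = d - c" for c d :: real
  by simp

lemma left_end_in_Inf_image:
  fixes p q :: real
  assumes "{p..q} \<in> \<B>" "p < q"
  shows "p \<in> Inf ` \<B>"
proof (rule rev_image_eqI[OF assms(1)])
  show "p = Inf {p..q}" using assms(2) by simp
qed

lemma cuts_intoD:
  assumes "cuts_into I \<G> \<B>"
  shows "finite \<G>" "\<G> \<noteq> {}" "disjoint \<G>" "finite \<B>" "disjoint \<B>"
    and "card \<B> = card \<G> + 1" "I - \<Union>\<G> = \<Union>\<B>"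
  using assms unfolding cuts_into_def by - (elim conjE, assumption)+

lemma cuts_into_gapE:
  assumes "cuts_into I \<G> \<B>" "G \<in> \<G>"
  obtains u v where "u < v" "G = {u<..<v}" "G \<subseteq> I"
proof -
  have "\<forall>G\<in>\<G>. \<exists>u v. u < v \<and> G = {u<..<v} \<and> G \<subseteq> I"
    using assms(1) unfolding cuts_into_def by (elim conjE)
  then show ?thesis using assms(2) that by metis
qed

lemma cuts_into_bridgeE:
  assumes "cuts_into I \<G> \<B>" "J \<in> \<B>"
  obtains p q where "p < q" "J = {p..q}" "J \<subseteq> I"
proof -
  have "\<forall>J\<in>\<B>. \<exists>p q. p < q \<and> J = {p..q}"
    using assms(1) unfolding cuts_into_def by (elim conjE)
  then obtain p q where "p < q" "J = {p..q}" using assms(2) by metis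
  moreover have "J \<subseteq> I" using cuts_intoD(7)[OF assms(1)] assms(2) by blast
  ultimately show ?thesis using that by metis
qed

text \<open>An open interval around an endpoint of a gap meets that gap, but gaps are disjoint.\<close>

lemma gap_endpoint_not_in_gap:
  assumes "cuts_into I \<G> \<B>" "{u<..<v} \<in> \<G>" "u < v" "w = u \<or> w = v"
  shows "w \<notin> \<Union>\<G>"
proof
  assume "w \<in> \<Union>\<G>"
  then obtain G where G: "G \<in> \<G>" "w \<in> G" by blast
  then obtain u' v' where uv': "u' < v'" "G = {u'<..<v'}"
    using cuts_into_gapE[OF assms(1)] by metis
  have "w \<notin> {u<..<v}" using assms(4) by auto
  then have "G \<noteq> {u<..<v}" using G by blast
  then have disj: "{u'<..<v'} \<inter> {u<..<v} = {}"
    using disjointD[OF cuts_intoD(3)[OF assms(1)] G(1) assms(2)] uv' by simp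
  have w: "u' < w" "w < v'" using G uv' by auto
  show False
  proof (cases "w = u")
    case True
    have "(u + min v v') / 2 \<in> {u'<..<v'} \<inter> {u<..<v}"
      using w assms(3) True by (auto simp: min_def field_simps)
    then show False using disj by blast
  next
    case False
    then have "w = v" using assms(4) by simp
    then have "(v + max u u') / 2 \<in> {u'<..<v'} \<inter> {u<..<v}"
      using w assms(3) by (auto simp: max_def field_simps)
    then show False using disj by blast
  qed
qed

lemma cuts_into_left_end:
  assumes cut: "cuts_into {c..d} \<G> \<B>" and "c < d"
  obtains q where "c < q" "{c..q} \<in> \<B>"
proof -
  have "c \<notin> \<Union>\<G>"
  proof
    assume "c \<in> \<Union>\<G>"
    then obtain G where "G \<in> \<G>" "c \<in> G" by blast
    then obtain u v where uv: "u < v" "{u<..<v} \<subseteq> {c..d}" "c \<in> {u<..<v}"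
      using cuts_into_gapE[OF cut] by metis
    then have "(u + c) / 2 \<in> {u<..<v}" by auto
    then have "(u + c) / 2 \<in> {c..d}" using uv by blast
    then show False using uv by simp
  qed
  moreover have "c \<in> {c..d}" using \<open>c < d\<close> by simp
  ultimately have "c \<in> \<Union>\<B>" using cuts_intoD(7)[OF cut] by blast
  then obtain J where J: "J \<in> \<B>" "c \<in> J" by blast
  then obtain p q where pq: "p < q" "J = {p..q}" "J \<subseteq> {c..d}" using cuts_into_bridgeE[OF cut] by metis
  then have "p = c" using J by auto
  then show ?thesis using that pq(1,2) J(1) by simp
qed

lemma cuts_into_right_end:
  assumes cut: "cuts_into {c..d} \<G> \<B>" and "c < d"
  obtains p where "p < d" "{p..d} \<in> \<B>"
proof -
  have "d \<notin> \<Union>\<G>"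
  proof
    assume "d \<in> \<Union>\<G>"
    then obtain G where "G \<in> \<G>" "d \<in> G" by blast
    then obtain u v where uv: "u < v" "{u<..<v} \<subseteq> {c..d}" "d \<in> {u<..<v}"
      using cuts_into_gapE[OF cut] by metis
    then have "(v + d) / 2 \<in> {u<..<v}" by auto
    then have "(v + d) / 2 \<in> {c..d}" using uv by blast
    then show False using uv by simp
  qed
  moreover have "d \<in> {c..d}" using \<open>c < d\<close> by simp
  ultimately have "d \<in> \<Union>\<B>" using cuts_intoD(7)[OF cut] by blast
  then obtain J where J: "J \<in> \<B>" "d \<in> J" by blast
  then obtain p q where pq: "p < q" "J = {p..q}" "J \<subseteq> {c..d}" using cuts_into_bridgeE[OF cut] by metis
  then have "q = d" using J by auto
  then show ?thesis using that pq(1,2) J(1) by simp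
qed

text \<open>The next bridge to the right is the one with the least left endpoint beyond \<open>q\<close>. Everything
  strictly between is covered by the gaps, and the endpoints of a gap lie in no gap, so a single
  gap fills the space between.\<close>

lemma next_bridge:
  assumes cut: "cuts_into {c..d} \<G> \<B>" and pq: "{p..q} \<in> \<B>" "p < q" and "q \<noteq> d"
  obtains p' q' where "q < p'" "p' < q'" "{q<..<p'} \<in> \<G>" "{p'..q'} \<in> \<B>"
proof -
  have sub: "{p..q} \<subseteq> {c..d}" using cuts_into_bridgeE[OF cut pq(1)] by metis
  then have cd: "c < d" and qd: "q < d" using pq(2) \<open>q \<noteq> d\<close> by auto
  have disjB: "disjoint \<B>" and cover: "{c..d} - \<Union>\<G> = \<Union>\<B>" and finB: "finite \<B>"
    using cuts_intoD[OF cut] by blast+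
  have apart: "q < x" if "{x..y} \<in> \<B>" "q < y" for x y
  proof (rule ccontr)
    assume "\<not> q < x"
    then have "q \<in> {x..y} \<inter> {p..q}" using that pq by auto
    then have "{x..y} = {p..q}" using disjointD[OF disjB that(1) pq(1)] by blast
    moreover have "y \<in> {x..y}" using \<open>\<not> q < x\<close> that by simp
    ultimately show False using that by auto
  qed
  define S where "S = {x \<in> Inf ` \<B>. q < x}"
  obtain x where x: "x < d" "{x..d} \<in> \<B>" using cuts_into_right_end[OF cut cd] .
  then have "x \<in> S" unfolding S_def using apart[of x d] qd left_end_in_Inf_image by blast
  then have S: "finite S" "S \<noteq> {}" unfolding S_def using finB by auto
  define p' where "p' = Min S"
  have "p' \<in> S" unfolding p'_def using S by simp
  then obtain J where J: "J \<in> \<B>" "p' = Inf J" "q < p'" unfolding S_def by blast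
  then obtain a q' where "a < q'" "J = {a..q'}" "J \<subseteq> {c..d}"
    using cuts_into_bridgeE[OF cut] by metis
  with J have J': "{p'..q'} \<in> \<B>" "p' < q'" "p' \<le> d" by auto
  have free: "z \<in> \<Union>\<G>" if z: "q < z" "z < p'" for z
  proof (rule ccontr)
    assume "z \<notin> \<Union>\<G>"
    moreover have "z \<in> {c..d}" using z J' sub pq(2) by auto
    ultimately have "z \<in> \<Union>\<B>" using cover by blast
    then obtain Jz where Jz: "Jz \<in> \<B>" "z \<in> Jz" by blast
    then obtain x y where xy: "x < y" "Jz = {x..y}" using cuts_into_bridgeE[OF cut] by metis
    then have "q < x" using apart Jz z by auto
    then have "x \<in> S" unfolding S_def using Jz xy left_end_in_Inf_image by blast
    then have "p' \<le> x" unfolding p'_def using S by simp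
    then show False using Jz xy z by auto
  qed
  have "(q + p') / 2 \<in> \<Union>\<G>" using free J by auto
  then obtain G where "G \<in> \<G>" "(q + p') / 2 \<in> G" by blast
  then obtain u v where uv: "u < v" "{u<..<v} \<in> \<G>" "(q + p') / 2 \<in> {u<..<v}"
    using cuts_into_gapE[OF cut] by metis
  have ends: "u \<notin> \<Union>\<G>" "v \<notin> \<Union>\<G>"
    using gap_endpoint_not_in_gap[OF cut uv(2,1)] by blast+
  have "q \<in> \<Union>\<B>" "p' \<in> \<Union>\<B>"
    using pq J' by (intro UnionI[of "{p..q}"] UnionI[of "{p'..q'}"]; simp)+
  then have "q \<notin> \<Union>\<G>" "p' \<notin> \<Union>\<G>" using cover by blast+
  then have "q \<notin> {u<..<v}" "p' \<notin> {u<..<v}" using uv by blast+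
  then have "q \<le> u" "v \<le> p'" using uv J by auto
  moreover have "u \<le> q" "p' \<le> v" using ends free[of u] free[of v] uv J by force+
  ultimately have "u = q" "v = p'" by auto
  then show ?thesis using that J J' uv by blast
qed

text \<open>In the application \<open>g\<close> and \<open>h\<close> are the restrictions of \<open>f\<close> to two opposite sides of a rectangle.
  The intervals from \<open>g p\<close> to \<open>h q\<close>, for the bridges from \<open>p\<close> to \<open>q\<close>, together leave no hole
  between \<open>g c\<close> and \<open>h d\<close> as soon as across each gap the next interval starts no later than the
  previous one ends. The rightmost bridge with \<open>g p \<le> t\<close> is the one that captures \<open>t\<close>.\<close>

lemma bridge_capturing_value:
  fixes g h :: "real \<Rightarrow> real"
  assumes cut: "cuts_into {c..d} \<G> \<B>" and "c < d" "g c \<le> t" "t \<le> h d"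
    and jump: "\<And>u v. {u<..<v} \<in> \<G> \<Longrightarrow> u < v \<Longrightarrow> g v \<le> h u"
  obtains p q where "p < q" "{p..q} \<in> \<B>" "g p \<le> t" "t \<le> h q"
proof -
  define S where "S = {x \<in> Inf ` \<B>. g x \<le> t}"
  have finB: "finite \<B>" using cuts_intoD[OF cut] by blast
  obtain e where e: "c < e" "{c..e} \<in> \<B>" using cuts_into_left_end[OF cut \<open>c < d\<close>] .
  then have "c \<in> S" unfolding S_def using \<open>g c \<le> t\<close> left_end_in_Inf_image by blast
  then have S: "finite S" "S \<noteq> {}" unfolding S_def using finB by auto
  define p where "p = Max S"
  have "p \<in> S" unfolding p_def using S by simp
  then obtain J where J: "J \<in> \<B>" "p = Inf J" "g p \<le> t" unfolding S_def by blast
  then obtain a q where "a < q" "J = {a..q}" using cuts_into_bridgeE[OF cut] by metis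
  with J have pq: "{p..q} \<in> \<B>" "p < q" by auto
  have "t \<le> h q"
  proof (rule ccontr)
    assume less: "\<not> t \<le> h q"
    then have "q \<noteq> d" using \<open>t \<le> h d\<close> by auto
    then obtain p' q' where n: "q < p'" "p' < q'" "{q<..<p'} \<in> \<G>" "{p'..q'} \<in> \<B>"
      using next_bridge[OF cut pq] by blast
    have "g p' \<le> t" using jump[OF n(3,1)] less by simp
    then have "p' \<in> S" unfolding S_def using n left_end_in_Inf_image by blast
    then have "p' \<le> p" unfolding p_def using S by simp
    then show False using n pq by simp
  qed
  then show ?thesis using that pq J by blast
qed

text \<open>There is at least one gap, hence there are two bridges, and disjoint intervals fit side by side.\<close>

lemma bridge_has_sibling:
  assumes cut: "cuts_into {c..d} \<G> \<B>" and J: "{p..q} \<in> \<B>" "p < q"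
  obtains J' where "J' \<in> \<B>" "len {p..q} + len J' \<le> d - c"
proof -
  have B: "finite \<B>" "card \<B> = card \<G> + 1" "card \<G> > 0" "disjoint \<B>"
    using cuts_intoD[OF cut] by (simp_all add: card_gt_0_iff)
  have "\<B> \<noteq> {{p..q}}" using B by auto
  then obtain J' where J': "J' \<in> \<B>" "J' \<noteq> {p..q}" using J by blast
  then obtain a b where ab: "a < b" "J' = {a..b}" "J' \<subseteq> {c..d}"
    using cuts_into_bridgeE[OF cut] by metis
  have sub: "{p..q} \<subseteq> {c..d}" using cuts_into_bridgeE[OF cut J(1)] by metis
  have "{a..b} \<inter> {p..q} = {}" using disjointD[OF B(4), of J' "{p..q}"] J(1) J' ab(2) by simp
  moreover have "max a p \<in> {a..b} \<inter> {p..q}" if "\<not> b < p" "\<not> q < a"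
    using that ab(1) J(2) by auto
  ultimately have "b < p \<or> q < a" by blast
  then have "len {p..q} + len J' \<le> d - c" using ab sub J(2) by auto
  then show ?thesis using that J' by blast
qed

section \<open>Bridges and gaps of one Cantor set\<close>

locale cantor =
  fixes A B :: real and F D :: "nat \<Rightarrow> real set set"
  assumes construction: "cantor_construction A B F D"
begin

lemma root: "A < B" "F 0 = {{A..B}}" "{A..B} \<in> F 0"
  using construction unfolding cantor_construction_def by auto

lemma cuts: "I \<in> F k \<Longrightarrow> cuts_into I {G \<in> D (Suc k). G \<subseteq> I} {J \<in> F (Suc k). J \<subseteq> I}"
  using construction unfolding cantor_construction_def by blast

lemma bridge_in_father: "J \<in> F (Suc k) \<Longrightarrow> \<exists>I\<in>F k. J \<subseteq> I"
  using construction unfolding cantor_construction_def by blast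

lemma gap_in_father: "G \<in> D (Suc k) \<Longrightarrow> \<exists>I\<in>F k. G \<subseteq> I"
  using construction unfolding cantor_construction_def by blast

lemma bridgeE:
  assumes "I \<in> F k" obtains c d where "c < d" "I = {c..d}"
proof (cases k)
  case 0
  then show ?thesis using assms root that by auto
next
  case (Suc j)
  then obtain I' where "I' \<in> F j" "I \<subseteq> I'" using assms bridge_in_father by blast
  then have "I \<in> {J \<in> F (Suc j). J \<subseteq> I'}" using assms Suc by auto
  then show ?thesis using cuts_into_bridgeE[OF cuts[OF \<open>I' \<in> F j\<close>]] that by metis
qed

lemma gapE:
  assumes "G \<in> D (Suc k)" obtains u v where "u < v" "G = {u<..<v}"
proof -
  obtain I where "I \<in> F k" "G \<subseteq> I" using assms gap_in_father by blast
  then have "G \<in> {G \<in> D (Suc k). G \<subseteq> I}" using assms by blast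
  then show ?thesis using cuts_into_gapE[OF cuts[OF \<open>I \<in> F k\<close>]] that by metis
qed

lemma bridge_Icc_less: "{c..d} \<in> F k \<Longrightarrow> c < d"
  by (metis bridgeE atLeastatMost_empty_iff2 Icc_eq_Icc not_le order.strict_implies_order)

lemma bridges_disjoint:
  "I \<in> F k \<Longrightarrow> J \<in> F k \<Longrightarrow> I \<inter> J \<noteq> {} \<Longrightarrow> I = J"
proof (induction k arbitrary: I J)
  case 0
  then show ?case using root by simp
next
  case (Suc k)
  obtain I' J' where f: "I' \<in> F k" "I \<subseteq> I'" "J' \<in> F k" "J \<subseteq> J'"
    using Suc.prems bridge_in_father by metis
  then have "I' = J'" using Suc.IH[of I' J'] Suc.prems(3) by blast
  then have "I \<in> {J \<in> F (Suc k). J \<subseteq> I'}" "J \<in> {J \<in> F (Suc k). J \<subseteq> I'}"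
    using f Suc.prems by auto
  from disjointD[OF cuts_intoD(5)[OF cuts[OF f(1)]] this] show ?case using Suc.prems(3) by blast
qed

lemma father_eq:
  assumes "I \<in> F k" "S \<subseteq> I" "S \<noteq> {}"
  shows "father F (Suc k) S = I"
  unfolding father_def
proof (rule the_equality)
  show "I \<in> F (Suc k - 1) \<and> S \<subseteq> I" using assms by simp
  fix J assume "J \<in> F (Suc k - 1) \<and> S \<subseteq> J"
  then show "J = I" using assms bridges_disjoint[of J k I] by auto
qed

lemma finite_bridges: "finite (F k)"
proof (induction k)
  case 0
  then show ?case using root by simp
next
  case (Suc k)
  have "F (Suc k) = (\<Union>I\<in>F k. {J \<in> F (Suc k). J \<subseteq> I})" using bridge_in_father by blast
  moreover have "finite {J \<in> F (Suc k). J \<subseteq> I}" if "I \<in> F k" for I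
    using cuts_intoD(4)[OF cuts[OF that]] .
  ultimately show ?case using Suc by (metis (no_types, lifting) finite_UN_I)
qed

lemma stage_antimono: "j \<le> k \<Longrightarrow> \<Union>(F k) \<subseteq> \<Union>(F j)"
proof (induction rule: dec_induct)
  case (step n)
  then show ?case using bridge_in_father by blast
qed simp

lemma bridge_subset_hull: "I \<in> F k \<Longrightarrow> I \<subseteq> {A..B}"
  using stage_antimono[of 0 k] root by auto

text \<open>Gaps are open subsets of the bridge that they are removed from, so an endpoint of a bridge
  survives, and is again an endpoint of a bridge one level deeper.\<close>

lemma bridge_endpoints_in_stage:
  assumes "{c..d} \<in> F k"
  shows "(\<exists>q. {c..q} \<in> F (k + n)) \<and> (\<exists>p. {p..d} \<in> F (k + n))"
proof (induction n)
  case 0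
  then show ?case using assms by auto
next
  case (Suc n)
  then obtain p q where pq: "{c..q} \<in> F (k + n)" "{p..d} \<in> F (k + n)" by blast
  obtain q' where "c < q'" "{c..q'} \<in> {J \<in> F (Suc (k + n)). J \<subseteq> {c..q}}"
    using cuts_into_left_end[OF cuts[OF pq(1)] bridge_Icc_less[OF pq(1)]] .
  moreover obtain p' where "p' < d" "{p'..d} \<in> {J \<in> F (Suc (k + n)). J \<subseteq> {p..d}}"
    using cuts_into_right_end[OF cuts[OF pq(2)] bridge_Icc_less[OF pq(2)]] .
  ultimately show ?case by auto
qed

lemma bridge_endpoints_in_cantor_set:
  assumes "{c..d} \<in> F k"
  shows "c \<in> cantor_set F" "d \<in> cantor_set F"
proof -
  have "c \<in> \<Union>(F j) \<and> d \<in> \<Union>(F j)" for j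
  proof -
    obtain p q where pq: "{c..q} \<in> F (k + j)" "{p..d} \<in> F (k + j)"
      using bridge_endpoints_in_stage[OF assms] by blast
    then have "c \<in> {c..q}" "d \<in> {p..d}" using bridge_Icc_less by fastforce+
    then have "c \<in> \<Union>(F (k + j))" "d \<in> \<Union>(F (k + j))" using pq by blast+
    then show ?thesis using stage_antimono[of j "k + j"] by auto
  qed
  then show "c \<in> cantor_set F" "d \<in> cantor_set F" unfolding cantor_set_def by auto
qed

lemma cantor_set_subset_hull: "cantor_set F \<subseteq> {A..B}"
  unfolding cantor_set_def using stage_antimono[of 0 1] root by auto

lemma compact_cantor_set: "compact (cantor_set F)"
proof -
  have "closed (\<Union>(F k))" for k
    by (intro closed_Union finite_bridges) (metis bridgeE closed_atLeastAtMost)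
  then have "closed (cantor_set F)" unfolding cantor_set_def by blast
  moreover have "bounded (cantor_set F)"
    using cantor_set_subset_hull bounded_closed_interval bounded_subset by blast
  ultimately show ?thesis using compact_eq_bounded_closed by blast
qed

lemma bridge_ratio_ge:
  assumes "{c..d} \<in> F k" "J \<in> F (Suc k)" "J \<subseteq> {c..d}" and s: "s \<le> Inf (bridge_ratios F)"
  shows "s * (d - c) \<le> len J"
proof -
  have cd: "c < d" using bridge_Icc_less assms(1) .
  have "J \<noteq> {}" using bridgeE[OF assms(2)] by force
  then have father: "father F (Suc k) J = {c..d}" using father_eq assms by blast
  have "len J / len (father F (Suc k) J) \<in> bridge_ratios F"
    unfolding bridge_ratios_def using assms(2) by force
  moreover have "bdd_below (bridge_ratios F)"
    unfolding bridge_ratios_def by (intro bdd_belowI[of _ 0]) auto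
  ultimately have "Inf (bridge_ratios F) \<le> len J / len (father F (Suc k) J)"
    using cInf_lower by blast
  then have "s \<le> len J / (d - c)" using s father cd by simp
  then show ?thesis using cd by (simp add: field_simps)
qed

text \<open>Every bridge has a sibling, which takes up at least the proportion \<open>s\<close> of the father.
  Hence bridges shrink geometrically once \<open>s\<close> is positive.\<close>

lemma bridge_ratio_le:
  assumes "{c..d} \<in> F k" "{p..q} \<in> F (Suc k)" "{p..q} \<subseteq> {c..d}"
    and s: "s \<le> Inf (bridge_ratios F)"
  shows "q - p \<le> (1 - s) * (d - c)"
proof -
  have pq: "p < q" using bridge_Icc_less assms(2) .
  have "{p..q} \<in> {J \<in> F (Suc k). J \<subseteq> {c..d}}" using assms by blast
  then obtain J' where J': "J' \<in> {J \<in> F (Suc k). J \<subseteq> {c..d}}" "len {p..q} + len J' \<le> d - c"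
    using bridge_has_sibling[OF cuts[OF assms(1)] _ pq] by blast
  then have "s * (d - c) \<le> len J'" using bridge_ratio_ge[OF assms(1) _ _ s] by blast
  then show ?thesis using J'(2) pq by (simp add: algebra_simps)
qed

lemma len_gap_le_father:
  assumes "{c..d} \<in> F k" "G \<in> D (Suc k)" "G \<subseteq> {c..d}"
  shows "0 < len G" "len G \<le> d - c"
proof -
  obtain u v where uv: "u < v" "G = {u<..<v}" using gapE[OF assms(2)] .
  then have "{u..v} \<subseteq> {c..d}" using assms(3) by (simp add: greaterThanLessThan_subseteq_atLeastAtMost_iff)
  then show "0 < len G" "len G \<le> d - c" using uv by auto
qed

text \<open>Gaps deleted from a bridge of level at least one are those counted in the gap ratios.
  They are bounded by one, so that their supremum is meaningful.\<close>

lemma gap_ratio_le_Sup: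
  assumes "{c..d} \<in> F (Suc k)" "G \<in> D (Suc (Suc k))" "G \<subseteq> {c..d}"
  shows "len G / (d - c) \<le> Sup (gap_ratios F D)"
proof -
  have ne: "S \<noteq> {}" if "S \<in> D (Suc j)" for S j using gapE[OF that] by force
  have "bdd_above (gap_ratios F D)"
  proof (rule bdd_aboveI[of _ 1])
    fix r assume "r \<in> gap_ratios F D"
    then obtain j S where S: "r = len S / len (father F (Suc j) S)" "S \<in> D (Suc j)"
      unfolding gap_ratios_def by (auto simp: Suc_le_eq gr0_conv_Suc)
    then obtain I where I: "I \<in> F j" "S \<subseteq> I" using gap_in_father by blast
    obtain a b where ab: "a < b" "I = {a..b}" using bridgeE[OF I(1)] .
    have "father F (Suc j) S = {a..b}" using father_eq[OF I ne[OF S(2)]] ab by simp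
    moreover have "len S \<le> b - a" using len_gap_le_father[of a b j S] I S ab by simp
    ultimately show "r \<le> 1" using S ab by simp
  qed
  moreover have "len G / (d - c) \<in> gap_ratios F D"
  proof -
    have "G \<subseteq> \<Union>(F 1)" using stage_antimono[of 1 "Suc k"] assms by auto
    moreover have "len (father F (Suc (Suc k)) G) = d - c"
      using father_eq[OF assms(1,3) ne[OF assms(2)]] bridge_Icc_less[OF assms(1)] by simp
    ultimately show ?thesis unfolding gap_ratios_def using assms(2)
      by (metis (mono_tags, lifting) One_nat_def Suc_le_mono le0 mem_Collect_eq)
  qed
  ultimately show ?thesis using cSup_upper by blast
qed

lemma Sup_gap_ratios_pos: "0 < Sup (gap_ratios F D)"
proof -
  obtain q where "A < q" "{A..q} \<in> {J \<in> F (Suc 0). J \<subseteq> {A..B}}"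
    using cuts_into_left_end[OF cuts[OF root(3)] root(1)] .
  then have q: "A < q" "{A..q} \<in> F 1" by simp_all
  then obtain G where G: "G \<in> D (Suc 1)" "G \<subseteq> {A..q}"
    using cuts_intoD(2)[OF cuts[OF q(2)]] by blast
  have "0 < len G / (q - A)" using len_gap_le_father[OF q(2) G] q by simp
  also have "\<dots> \<le> Sup (gap_ratios F D)" using gap_ratio_le_Sup[of A q 0 G] q G by simp
  finally show ?thesis .
qed

lemma first_gap_le_Max: "{u<..<v} \<in> D 1 \<Longrightarrow> u < v \<Longrightarrow> v - u \<le> Max (len ` D 1)"
proof -
  assume uv: "{u<..<v} \<in> D 1" "u < v"
  have "G \<subseteq> {A..B}" if "G \<in> D (Suc 0)" for G using gap_in_father[OF that] root(2) by simp
  then have "D 1 = {G \<in> D (Suc 0). G \<subseteq> {A..B}}" by (simp add: set_eq_iff) blast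
  then have "finite (D 1)" using cuts_intoD(1)[OF cuts[OF root(3)]] by simp
  then have "len {u<..<v} \<le> Max (len ` D 1)" using uv(1) by (intro Max_ge finite_imageI imageI)
  then show ?thesis using uv by simp
qed

lemma Min_le_first_bridge: "{p..q} \<in> F 1 \<Longrightarrow> Min (len ` F 1) \<le> q - p"
proof -
  assume pq: "{p..q} \<in> F 1"
  then have "Min (len ` F 1) \<le> len {p..q}" by (intro Min_le finite_imageI finite_bridges imageI)
  then show ?thesis using bridge_Icc_less[OF pq] by simp
qed

lemma child_capturing_value:
  fixes g h :: "real \<Rightarrow> real"
  assumes I: "{c..d} \<in> F k" and "g c \<le> t" "t \<le> h d"
    and s: "s \<le> Inf (bridge_ratios F)"
    and jump: "\<And>u v. {u<..<v} \<in> D (Suc k) \<Longrightarrow> c \<le> u \<Longrightarrow> u < v \<Longrightarrow> v \<le> d \<Longrightarrow> g v \<le> h u"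
  obtains p q where "{p..q} \<in> F (Suc k)" "g p \<le> t" "t \<le> h q"
    "s * (d - c) \<le> q - p" "q - p \<le> (1 - s) * (d - c)"
proof -
  have cd: "c < d" using bridge_Icc_less[OF I] .
  have j: "g v \<le> h u" if "{u<..<v} \<in> {G \<in> D (Suc k). G \<subseteq> {c..d}}" "u < v" for u v
    using that jump by (simp add: greaterThanLessThan_subseteq_atLeastAtMost_iff)
  obtain p q where pq: "p < q" "{p..q} \<in> {J \<in> F (Suc k). J \<subseteq> {c..d}}" "g p \<le> t" "t \<le> h q"
    by (rule bridge_capturing_value[where g = g and h = h and t = t, OF cuts[OF I] cd assms(2,3)])
      (rule j that; assumption)+
  then have J: "{p..q} \<in> F (Suc k)" "{p..q} \<subseteq> {c..d}" using pq(2) by simp_all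
  have "s * (d - c) \<le> q - p" using bridge_ratio_ge[OF I J s] pq(1) by simp
  then show ?thesis by (rule that[OF J(1) pq(3,4) _ bridge_ratio_le[OF I J s]])
qed

text \<open>From the first level on the gaps of an interval are at most \<open>\<kappa>\<close> times its length, so it is
  enough to cross gaps of that size.\<close>

lemma deep_child_capturing_value:
  fixes g h :: "real \<Rightarrow> real"
  assumes I: "{c..d} \<in> F (Suc k)" and "g c \<le> t" "t \<le> h d"
    and s: "s \<le> Inf (bridge_ratios F)" and \<kappa>: "Sup (gap_ratios F D) \<le> \<kappa>"
    and jump: "\<And>u v. c \<le> u \<Longrightarrow> u < v \<Longrightarrow> v \<le> d \<Longrightarrow> v - u \<le> \<kappa> * (d - c) \<Longrightarrow> g v \<le> h u"
  obtains p q where "{p..q} \<in> F (Suc (Suc k))" "g p \<le> t" "t \<le> h q"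
    "s * (d - c) \<le> q - p" "q - p \<le> (1 - s) * (d - c)"
proof -
  have "g v \<le> h u" if uv: "{u<..<v} \<in> D (Suc (Suc k))" "c \<le> u" "u < v" "v \<le> d" for u v
  proof -
    have "{u<..<v} \<subseteq> {c..d}" using uv by auto
    then have "len {u<..<v} / (d - c) \<le> \<kappa>" using gap_ratio_le_Sup[OF I uv(1)] \<kappa> by linarith
    then have "v - u \<le> \<kappa> * (d - c)" using uv by (simp add: field_simps)
    then show ?thesis using jump uv by blast
  qed
  then show ?thesis using child_capturing_value[where g = g and h = h and t = t, OF I assms(2,3) s] that by metis
qed

end

section \<open>Monotonicity of a differentiable function along segments\<close>

lemma le_along_segment:
  fixes f :: "'a::real_normed_vector \<Rightarrow> real"
  assumes der: "\<And>z. (f has_derivative f' z) (at z)"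
    and nonneg: "\<And>z. z \<in> closed_segment P Q \<Longrightarrow> 0 \<le> f' z (Q - P)"
  shows "f P \<le> f Q"
proof -
  define \<phi> where "\<phi> t = f (P + t *\<^sub>R (Q - P))" for t :: real
  have d: "DERIV \<phi> t :> f' (P + t *\<^sub>R (Q - P)) (Q - P)" for t
  proof -
    have "(\<phi> has_derivative (\<lambda>h. f' (P + t *\<^sub>R (Q - P)) (h *\<^sub>R (Q - P)))) (at t)"
      unfolding \<phi>_def by (rule has_derivative_compose[OF _ der]) (auto intro!: derivative_eq_intros)
    moreover have "f' (P + t *\<^sub>R (Q - P)) (h *\<^sub>R (Q - P)) = f' (P + t *\<^sub>R (Q - P)) (Q - P) * h" for h
      using linear_scale[OF has_derivative_linear[OF der]] by simp
    ultimately show ?thesis unfolding has_field_derivative_def by (simp add: fun_eq_iff)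
  qed
  have "\<phi> 0 \<le> \<phi> 1"
  proof (rule DERIV_nonneg_imp_nondecreasing[of 0 1 \<phi>])
    fix t :: real assume t: "0 \<le> t" "t \<le> 1"
    have "P + t *\<^sub>R (Q - P) = (1 - t) *\<^sub>R P + t *\<^sub>R Q" by (simp add: algebra_simps)
    then have "P + t *\<^sub>R (Q - P) \<in> closed_segment P Q" using t unfolding in_segment by auto
    then show "\<exists>y. DERIV \<phi> t :> y \<and> 0 \<le> y" using d nonneg by blast
  qed simp
  then show ?thesis unfolding \<phi>_def by simp
qed

lemma C1_le_if_directional_derivative_nonneg:
  fixes f :: "real \<times> real \<Rightarrow> real"
  assumes "C1 f"
    and nonneg: "\<And>\<xi> \<eta>. \<xi> \<in> closed_segment x x' \<Longrightarrow> \<eta> \<in> closed_segment y y' \<Longrightarrow>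
      0 \<le> (x' - x) * partial_x f \<xi> \<eta> + (y' - y) * partial_y f \<xi> \<eta>"
  shows "f (x, y) \<le> f (x', y')"
proof -
  obtain f' :: "real \<times> real \<Rightarrow> (real \<times> real) \<Rightarrow>\<^sub>L real"
    where der: "\<And>z. (f has_derivative blinfun_apply (f' z)) (at z)"
    using assms(1) unfolding C1_def by blast
  have px: "partial_x f \<xi> \<eta> = f' (\<xi>, \<eta>) (1, 0)" for \<xi> \<eta>
  proof -
    have "((\<lambda>t. f (t, \<eta>)) has_derivative (\<lambda>h. f' (\<xi>, \<eta>) (h, 0))) (at \<xi>)"
      by (rule has_derivative_compose[OF _ der]) (intro has_derivative_Pair has_derivative_const has_derivative_ident)
    moreover have "(\<lambda>h. f' (\<xi>, \<eta>) (h, 0)) = (\<lambda>h. f' (\<xi>, \<eta>) (1, 0) * h)"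
    proof
      fix h :: real
      show "f' (\<xi>, \<eta>) (h, 0) = f' (\<xi>, \<eta>) (1, 0) * h"
        using blinfun.scaleR_right[of "f' (\<xi>, \<eta>)" h "(1, 0)"] by (simp add: mult.commute)
    qed
    ultimately have "DERIV (\<lambda>t. f (t, \<eta>)) \<xi> :> f' (\<xi>, \<eta>) (1, 0)"
      unfolding has_field_derivative_def by (simp only:)
    then show ?thesis unfolding partial_x_def by (rule DERIV_imp_deriv)
  qed
  have py: "partial_y f \<xi> \<eta> = f' (\<xi>, \<eta>) (0, 1)" for \<xi> \<eta>
  proof -
    have "((\<lambda>t. f (\<xi>, t)) has_derivative (\<lambda>h. f' (\<xi>, \<eta>) (0, h))) (at \<eta>)"
      by (rule has_derivative_compose[OF _ der]) (intro has_derivative_Pair has_derivative_const has_derivative_ident)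
    moreover have "(\<lambda>h. f' (\<xi>, \<eta>) (0, h)) = (\<lambda>h. f' (\<xi>, \<eta>) (0, 1) * h)"
    proof
      fix h :: real
      show "f' (\<xi>, \<eta>) (0, h) = f' (\<xi>, \<eta>) (0, 1) * h"
        using blinfun.scaleR_right[of "f' (\<xi>, \<eta>)" h "(0, 1)"] by (simp add: mult.commute)
    qed
    ultimately have "DERIV (\<lambda>t. f (\<xi>, t)) \<eta> :> f' (\<xi>, \<eta>) (0, 1)"
      unfolding has_field_derivative_def by (simp only:)
    then show ?thesis unfolding partial_y_def by (rule DERIV_imp_deriv)
  qed
  show ?thesis
  proof (rule le_along_segment[OF der])
    fix z assume "z \<in> closed_segment (x, y) (x', y')"
    moreover obtain \<xi> \<eta> where z: "z = (\<xi>, \<eta>)" by fastforce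
    ultimately have in_box: "\<xi> \<in> closed_segment x x'" "\<eta> \<in> closed_segment y y'"
      using closed_segment_PairD by blast+
    have "(x', y') - (x, y) = (x' - x) *\<^sub>R (1, 0) + (y' - y) *\<^sub>R (0, 1::real)" by simp
    then have "f' z ((x', y') - (x, y)) = (x' - x) * f' z (1, 0) + (y' - y) * f' z (0, 1)"
      by (simp only: blinfun.add_right blinfun.scaleR_right real_scaleR_def)
    then show "0 \<le> f' z ((x', y') - (x, y))" using nonneg[OF in_box] z px py by simp
  qed
qed

section \<open>Splitting rectangles of bridges\<close>

text \<open>Here \<open>w\<close> is the length of a gap in a bridge of length \<open>a\<close> of the set with hull length \<open>L\<close>, the other
  bridge has length \<open>b\<close> in a hull of length \<open>M\<close>, and \<open>\<phi>\<close>, \<open>\<psi>\<close> are the corresponding partial derivatives.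
  The bridge \<open>b\<close> being at least \<open>s\<close> times as long as \<open>a\<close>, relative to the hulls, is exactly what turns
  the slope condition into a bound for the loss across the gap.\<close>

lemma jump_le_rise:
  fixes w a b \<kappa> s L M \<phi> \<psi> :: real
  assumes "0 < L" "0 < \<phi>" "0 < \<psi>" "0 \<le> a" "w \<le> \<kappa> * a"
    and slope: "\<kappa> * L * \<phi> \<le> s * M * \<psi>" and balance: "s * (a * M) \<le> b * L"
  shows "w * \<phi> \<le> b * \<psi>"
proof -
  have "w * \<phi> * L \<le> (\<kappa> * a) * \<phi> * L"
    using assms(1,2,5) by (intro mult_right_mono) auto
  also have "\<dots> = a * (\<kappa> * L * \<phi>)" by simp
  also have "\<dots> \<le> a * (s * M * \<psi>)" using slope assms(4) by (rule mult_left_mono)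
  also have "\<dots> = s * (a * M) * \<psi>" by simp
  also have "\<dots> \<le> b * L * \<psi>" using balance assms(3) by (intro mult_right_mono) auto
  finally have "w * \<phi> * L \<le> b * \<psi> * L" by (simp add: mult_ac)
  then show ?thesis using assms(1) by simp
qed

text \<open>The longer of two comparable lengths may be replaced by a child of it: the child is not shorter
  than \<open>s\<close> times its father, and the father was the longer one.\<close>

lemma balance_preserved:
  fixes X Y X' s :: real
  assumes "0 < s" "0 \<le> X" "0 \<le> Y" "Y \<le> X" "s * X \<le> Y" "s * X \<le> X'" "X' \<le> (1 - s) * X"
  shows "s * X' \<le> Y" "s * Y \<le> X'" "X' * Y \<le> (1 - s) * (X * Y)"
proof -
  have "0 \<le> s * X" using assms(1,2) by simp
  then have "X' \<le> X" using assms(7) by (simp add: left_diff_distrib)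
  then have "s * X' \<le> s * X" using assms(1) by simp
  then show "s * X' \<le> Y" using assms(5) by simp
  have "s * Y \<le> s * X" using assms(1,4) by simp
  then show "s * Y \<le> X'" using assms(6) by simp
  show "X' * Y \<le> (1 - s) * (X * Y)" using mult_right_mono[OF assms(7,3)] by (simp add: mult_ac)
qed

locale cantor_pair = K1: cantor A1 B1 F1 D1 + K2: cantor A2 B2 F2 D2
  for A1 B1 F1 D1 A2 B2 F2 D2 +
  fixes f :: "real \<times> real \<Rightarrow> real"
  assumes C1: "C1 f"
    and derivs: "\<And>x y. x \<in> {A1..B1} \<Longrightarrow> y \<in> {A2..B2} \<Longrightarrow>
      partial_x f x y > 0 \<and> partial_y f x y > 0 \<and>
      s_min F1 F2 * (B2 - A2) * partial_y f x y
        - kappa F1 D1 F2 D2 * (B1 - A1) * partial_x f x y \<ge> 0 \<and>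
      s_min F1 F2 * (B1 - A1) * partial_x f x y
        - kappa F1 D1 F2 D2 * (B2 - A2) * partial_y f x y \<ge> 0 \<and>
      (B2 - A2) * partial_y f x y \<ge> partial_x f x y * Max (len ` D1 1) \<and>
      partial_x f x y * Min (len ` F1 1) \<ge> partial_y f x y * Max (len ` D2 1)"
begin

abbreviation s where "s \<equiv> s_min F1 F2"
abbreviation \<kappa> where "\<kappa> \<equiv> kappa F1 D1 F2 D2"
abbreviation L1 where "L1 \<equiv> B1 - A1"
abbreviation L2 where "L2 \<equiv> B2 - A2"

lemma s_le: "s \<le> Inf (bridge_ratios F1)" "s \<le> Inf (bridge_ratios F2)"
  unfolding s_min_def by simp_all

lemma le_\<kappa>: "Sup (gap_ratios F1 D1) \<le> \<kappa>" "Sup (gap_ratios F2 D2) \<le> \<kappa>"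
  unfolding kappa_def by simp_all

lemma L_pos: "0 < L1" "0 < L2"
  using K1.root K2.root by simp_all

text \<open>Gaps of the second step exist, so \<open>\<kappa>\<close> is positive, and a vanishing \<open>s\<close> would contradict the slope
  conditions.\<close>

lemma s_pos: "0 < s"
proof -
  have in_box: "A1 \<in> {A1..B1}" "A2 \<in> {A2..B2}" using L_pos by simp_all
  have "0 < \<kappa>" using K1.Sup_gap_ratios_pos le_\<kappa>(1) by simp
  then have "0 < \<kappa> * L1 * partial_x f A1 A2" using derivs[OF in_box] L_pos by simp
  also have "\<dots> \<le> s * (L2 * partial_y f A1 A2)" using derivs[OF in_box] by (simp add: mult_ac)
  finally have "0 < s * (L2 * partial_y f A1 A2)" .
  moreover have "0 < L2 * partial_y f A1 A2" using derivs[OF in_box] L_pos by simp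
  ultimately show ?thesis by (rule zero_less_mult_pos2)
qed

lemma s_less_1: "s < 1"
proof -
  obtain q where "A1 < q" "{A1..q} \<in> {J \<in> F1 (Suc 0). J \<subseteq> {A1..B1}}"
    using cuts_into_left_end[OF K1.cuts[OF K1.root(3)] K1.root(1)] .
  then have J: "A1 < q" "{A1..q} \<in> F1 (Suc 0)" "{A1..q} \<subseteq> {A1..B1}" by simp_all
  have "0 < q - A1" using J(1) by simp
  also have "\<dots> \<le> (1 - s) * L1" by (rule K1.bridge_ratio_le[OF K1.root(3) J(2,3) s_le(1)])
  finally show ?thesis using zero_less_mult_pos2[of "1 - s" L1] L_pos by simp
qed

lemma le_in_rectangle:
  assumes box: "{x, x'} \<subseteq> {A1..B1}" "{y, y'} \<subseteq> {A2..B2}"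
    and nonneg: "\<And>\<xi> \<eta>. \<xi> \<in> {A1..B1} \<Longrightarrow> \<eta> \<in> {A2..B2} \<Longrightarrow>
      0 \<le> (x' - x) * partial_x f \<xi> \<eta> + (y' - y) * partial_y f \<xi> \<eta>"
  shows "f (x, y) \<le> f (x', y')"
proof -
  have "closed_segment x x' \<subseteq> {A1..B1}" "closed_segment y y' \<subseteq> {A2..B2}"
    using box by (simp_all add: closed_segment_subset)
  then show ?thesis
    by (intro C1_le_if_directional_derivative_nonneg[OF C1] nonneg) (erule subsetD, assumption)+
qed

lemma increasing:
  assumes "x \<le> x'" "y \<le> y'" "{x, x'} \<subseteq> {A1..B1}" "{y, y'} \<subseteq> {A2..B2}"
  shows "f (x, y) \<le> f (x', y')"
proof (rule le_in_rectangle[OF assms(3,4)])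
  fix \<xi> \<eta> assume "\<xi> \<in> {A1..B1}" "\<eta> \<in> {A2..B2}"
  from derivs[OF this] show "0 \<le> (x' - x) * partial_x f \<xi> \<eta> + (y' - y) * partial_y f \<xi> \<eta>"
    using assms(1,2) by (intro add_nonneg_nonneg mult_nonneg_nonneg) auto
qed

text \<open>Moving from \<open>(v, p)\<close> to \<open>(u, q)\<close> loses across the gap in the first coordinate and gains across the
  bridge in the second.\<close>

lemma cross_x_gap:
  assumes box: "{u, v} \<subseteq> {A1..B1}" "{p, q} \<subseteq> {A2..B2}"
    and slopes: "\<And>\<xi> \<eta>. \<xi> \<in> {A1..B1} \<Longrightarrow> \<eta> \<in> {A2..B2} \<Longrightarrow>
      (v - u) * partial_x f \<xi> \<eta> \<le> (q - p) * partial_y f \<xi> \<eta>"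
  shows "f (v, p) \<le> f (u, q)"
proof (rule le_in_rectangle)
  fix \<xi> \<eta> assume "\<xi> \<in> {A1..B1}" "\<eta> \<in> {A2..B2}"
  from slopes[OF this] show "0 \<le> (u - v) * partial_x f \<xi> \<eta> + (q - p) * partial_y f \<xi> \<eta>"
    by (simp add: left_diff_distrib)
qed (use box in auto)

lemma cross_y_gap:
  assumes box: "{u, v} \<subseteq> {A2..B2}" "{c, d} \<subseteq> {A1..B1}"
    and slopes: "\<And>\<xi> \<eta>. \<xi> \<in> {A1..B1} \<Longrightarrow> \<eta> \<in> {A2..B2} \<Longrightarrow>
      (v - u) * partial_y f \<xi> \<eta> \<le> (d - c) * partial_x f \<xi> \<eta>"
  shows "f (c, v) \<le> f (d, u)"
proof (rule le_in_rectangle)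
  fix \<xi> \<eta> assume "\<xi> \<in> {A1..B1}" "\<eta> \<in> {A2..B2}"
  from slopes[OF this] show "0 \<le> (d - c) * partial_x f \<xi> \<eta> + (u - v) * partial_y f \<xi> \<eta>"
    by (simp add: left_diff_distrib)
qed (use box in auto)

text \<open>The rectangle of the two bridges has \<open>t\<close> between the values of \<open>f\<close> at its lower left and upper
  right corners, and each of its sides, measured relative to the hull, is at least \<open>s\<close> times the other.
  The denominators are cleared. The last condition bounds the area after \<open>n\<close> splits.\<close>

definition captures :: "real \<Rightarrow> nat \<Rightarrow> real \<Rightarrow> real \<Rightarrow> real \<Rightarrow> real \<Rightarrow> bool" where
  "captures t n c d p q \<longleftrightarrow>
     (\<exists>k. {c..d} \<in> F1 (Suc k)) \<and> (\<exists>l. {p..q} \<in> F2 (Suc l)) \<and>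
     f (c, p) \<le> t \<and> t \<le> f (d, q) \<and>
     s * ((d - c) * L2) \<le> (q - p) * L1 \<and> s * ((q - p) * L1) \<le> (d - c) * L2 \<and>
     ((d - c) * L2) * ((q - p) * L1) \<le> (1 - s) ^ n * (L1 * L2)\<^sup>2"

text \<open>The first-step gaps are not controlled by \<open>\<kappa>\<close>. The whole second interval is long enough to
  cross those of the first set, and then any first-step bridge of the first set is long enough to
  cross those of the second.\<close>

lemma captures_start:
  assumes t: "f (A1, A2) \<le> t" "t \<le> f (B1, B2)"
  shows "\<exists>c d p q. captures t 0 c d p q"
proof -
  have jump1: "f (v, A2) \<le> f (u, B2)"
    if "{u<..<v} \<in> D1 (Suc 0)" "A1 \<le> u" "u < v" "v \<le> B1" for u v
  proof (rule cross_x_gap)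
    fix \<xi> \<eta> assume "\<xi> \<in> {A1..B1}" "\<eta> \<in> {A2..B2}"
    note D = derivs[OF this]
    have "(v - u) * partial_x f \<xi> \<eta> \<le> Max (len ` D1 1) * partial_x f \<xi> \<eta>"
      using K1.first_gap_le_Max[of u v] that D by (intro mult_right_mono) auto
    also have "\<dots> \<le> L2 * partial_y f \<xi> \<eta>" using D by (simp add: mult.commute)
    finally show "(v - u) * partial_x f \<xi> \<eta> \<le> L2 * partial_y f \<xi> \<eta>" .
  qed (use that L_pos in auto)
  obtain c d where cd: "{c..d} \<in> F1 (Suc 0)" "f (c, A2) \<le> t" "t \<le> f (d, B2)"
      "s * L1 \<le> d - c" "d - c \<le> (1 - s) * L1"
    by (rule K1.child_capturing_value[where g = "\<lambda>x. f (x, A2)" and h = "\<lambda>x. f (x, B2)",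
        OF K1.root(3) t s_le(1)])
        (rule jump1 that; assumption)+
  have c: "c < d" "{c, d} \<subseteq> {A1..B1}"
    using K1.bridge_Icc_less[OF cd(1)] K1.bridge_subset_hull[OF cd(1)] by auto
  have jump2: "f (c, v) \<le> f (d, u)"
    if "{u<..<v} \<in> D2 (Suc 0)" "A2 \<le> u" "u < v" "v \<le> B2" for u v
  proof (rule cross_y_gap)
    fix \<xi> \<eta> assume "\<xi> \<in> {A1..B1}" "\<eta> \<in> {A2..B2}"
    note D = derivs[OF this]
    have "(v - u) * partial_y f \<xi> \<eta> \<le> Max (len ` D2 1) * partial_y f \<xi> \<eta>"
      using K2.first_gap_le_Max[of u v] that D by (intro mult_right_mono) auto
    also have "\<dots> \<le> Min (len ` F1 1) * partial_x f \<xi> \<eta>" using D by (simp add: mult.commute)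
    also have "\<dots> \<le> (d - c) * partial_x f \<xi> \<eta>"
      using K1.Min_le_first_bridge[of c d] cd(1) D by (intro mult_right_mono) auto
    finally show "(v - u) * partial_y f \<xi> \<eta> \<le> (d - c) * partial_x f \<xi> \<eta>" .
  qed (use that c in auto)
  obtain p q where pq: "{p..q} \<in> F2 (Suc 0)" "f (c, p) \<le> t" "t \<le> f (d, q)"
      "s * L2 \<le> q - p" "q - p \<le> (1 - s) * L2"
    by (rule K2.child_capturing_value[where g = "\<lambda>y. f (c, y)" and h = "\<lambda>y. f (d, y)",
        OF K2.root(3) cd(2,3) s_le(2)])
        (rule jump2 that; assumption)+
  have p: "p < q" "{p, q} \<subseteq> {A2..B2}"
    using K2.bridge_Icc_less[OF pq(1)] K2.bridge_subset_hull[OF pq(1)] by auto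
  have le: "d - c \<le> L1" "q - p \<le> L2" using c p by auto
  have "s * ((d - c) * L2) = (d - c) * (s * L2)" by simp
  also have "\<dots> \<le> L1 * (q - p)" using le pq(4) c s_pos L_pos by (intro mult_mono) auto
  finally have b1: "s * ((d - c) * L2) \<le> (q - p) * L1" by (simp add: mult.commute)
  have "s * ((q - p) * L1) = (q - p) * (s * L1)" by simp
  also have "\<dots> \<le> L2 * (d - c)" using le cd(4) p s_pos L_pos by (intro mult_mono) auto
  finally have b2: "s * ((q - p) * L1) \<le> (d - c) * L2" by (simp add: mult.commute)
  have "((d - c) * L2) * ((q - p) * L1) \<le> (L1 * L2) * (L2 * L1)"
    using le c p L_pos by (intro mult_mono) auto
  also have "\<dots> = (1 - s) ^ 0 * (L1 * L2)\<^sup>2" by (simp add: power2_eq_square mult_ac)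
  finally have "captures t 0 c d p q" unfolding captures_def using cd pq b1 b2 by blast
  then show ?thesis by blast
qed

text \<open>Split the relatively longer side. The shorter one is still at least \<open>s\<close> times as long, which is
  what the slope conditions need for crossing all gaps of the longer side; the child has at least
  the proportion \<open>s\<close> of its father, so the sides stay comparable.\<close>

lemma captures_step:
  assumes "captures t n c d p q"
  shows "\<exists>c d p q. captures t (Suc n) c d p q"
proof -
  obtain k l where I: "{c..d} \<in> F1 (Suc k)" and J: "{p..q} \<in> F2 (Suc l)"
    using assms unfolding captures_def by blast
  have t: "f (c, p) \<le> t" "t \<le> f (d, q)"
    and bal: "s * ((d - c) * L2) \<le> (q - p) * L1" "s * ((q - p) * L1) \<le> (d - c) * L2"
    and small: "((d - c) * L2) * ((q - p) * L1) \<le> (1 - s) ^ n * (L1 * L2)\<^sup>2"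
    using assms unfolding captures_def by auto
  have c: "c < d" "{c, d} \<subseteq> {A1..B1}"
    using K1.bridge_Icc_less[OF I] K1.bridge_subset_hull[OF I] by auto
  have p: "p < q" "{p, q} \<subseteq> {A2..B2}"
    using K2.bridge_Icc_less[OF J] K2.bridge_subset_hull[OF J] by auto
  have nonneg: "0 \<le> (d - c) * L2" "0 \<le> (q - p) * L1" using c p L_pos by simp_all
  have shrink: "(1 - s) * (((d - c) * L2) * ((q - p) * L1)) \<le> (1 - s) ^ Suc n * (L1 * L2)\<^sup>2"
    using mult_left_mono[OF small, of "1 - s"] s_less_1 by (simp add: mult_ac)
  show ?thesis
  proof (cases "(q - p) * L1 \<le> (d - c) * L2")
    case True
    have jump: "f (v, p) \<le> f (u, q)"
      if "c \<le> u" "u < v" "v \<le> d" "v - u \<le> \<kappa> * (d - c)" for u v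
    proof (rule cross_x_gap)
      fix \<xi> \<eta> assume "\<xi> \<in> {A1..B1}" "\<eta> \<in> {A2..B2}"
      note D = derivs[OF this]
      show "(v - u) * partial_x f \<xi> \<eta> \<le> (q - p) * partial_y f \<xi> \<eta>"
        by (rule jump_le_rise[OF L_pos(1), where \<kappa> = \<kappa> and s = s and M = L2 and a = "d - c"])
          (use D c bal that in auto)
    qed (use that c p in auto)
    obtain c' d' where child: "{c'..d'} \<in> F1 (Suc (Suc k))" "f (c', p) \<le> t" "t \<le> f (d', q)"
        "s * (d - c) \<le> d' - c'" "d' - c' \<le> (1 - s) * (d - c)"
      by (rule K1.deep_child_capturing_value[where g = "\<lambda>x. f (x, p)" and h = "\<lambda>x. f (x, q)",
          OF I t s_le(1) le_\<kappa>(1)])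
        (rule jump that; assumption)+
    have "s * ((d - c) * L2) \<le> (d' - c') * L2" "(d' - c') * L2 \<le> (1 - s) * ((d - c) * L2)"
      using mult_right_mono[OF child(4), of L2] mult_right_mono[OF child(5), of L2] L_pos
      by (simp_all add: mult.assoc)
    note new = balance_preserved[OF s_pos nonneg True bal(1) this]
    have "captures t (Suc n) c' d' p q"
      unfolding captures_def using child J new order_trans[OF new(3) shrink] by blast
    then show ?thesis by blast
  next
    case False
    then have longer: "(d - c) * L2 \<le> (q - p) * L1" by simp
    have jump: "f (c, v) \<le> f (d, u)"
      if "p \<le> u" "u < v" "v \<le> q" "v - u \<le> \<kappa> * (q - p)" for u v
    proof (rule cross_y_gap)
      fix \<xi> \<eta> assume "\<xi> \<in> {A1..B1}" "\<eta> \<in> {A2..B2}"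
      note D = derivs[OF this]
      show "(v - u) * partial_y f \<xi> \<eta> \<le> (d - c) * partial_x f \<xi> \<eta>"
        by (rule jump_le_rise[OF L_pos(2), where \<kappa> = \<kappa> and s = s and M = L1 and a = "q - p"])
          (use D p bal that in auto)
    qed (use that c p in auto)
    obtain p' q' where child: "{p'..q'} \<in> F2 (Suc (Suc l))" "f (c, p') \<le> t" "t \<le> f (d, q')"
        "s * (q - p) \<le> q' - p'" "q' - p' \<le> (1 - s) * (q - p)"
      by (rule K2.deep_child_capturing_value[where g = "\<lambda>y. f (c, y)" and h = "\<lambda>y. f (d, y)",
          OF J t s_le(2) le_\<kappa>(2)])
        (rule jump that; assumption)+
    have "s * ((q - p) * L1) \<le> (q' - p') * L1" "(q' - p') * L1 \<le> (1 - s) * ((q - p) * L1)"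
      using mult_right_mono[OF child(4), of L1] mult_right_mono[OF child(5), of L1] L_pos
      by (simp_all add: mult.assoc)
    note new = balance_preserved[OF s_pos nonneg(2,1) longer bal(2) this]
    have "((d - c) * L2) * ((q' - p') * L1) \<le> (1 - s) * (((d - c) * L2) * ((q - p) * L1))"
      using new(3) by (simp add: mult_ac)
    then have "captures t (Suc n) c d p' q'"
      unfolding captures_def using child I new order_trans[OF _ shrink] by blast
    then show ?thesis by blast
  qed
qed

section \<open>The image of the product\<close>

lemma captures_all_depths:
  assumes "f (A1, A2) \<le> t" "t \<le> f (B1, B2)"
  shows "\<exists>c d p q. captures t n c d p q"
proof (induction n)
  case 0
  show ?case by (rule captures_start[OF assms])
next
  case (Suc n)
  then obtain c d p q where "captures t n c d p q" by blast
  then show ?case by (rule captures_step)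
qed

text \<open>Since the two sides are comparable, a small area forces both of them to be short.\<close>

lemma captured_in_small_rectangle:
  assumes t: "f (A1, A2) \<le> t" "t \<le> f (B1, B2)" and "0 < \<delta>"
  obtains c d p q k l where "{c..d} \<in> F1 k" "{p..q} \<in> F2 l" "d - c < \<delta>" "q - p < \<delta>"
    "f (c, p) \<le> t" "t \<le> f (d, q)"
proof -
  \<comment> \<open>It suffices that the products \<open>X\<close> and \<open>Y\<close> of either side with the opposite hull are below \<open>m\<close>.\<close>
  define m where "m = \<delta> * min L1 L2"
  have m: "0 < m" "m \<le> \<delta> * L1" "m \<le> \<delta> * L2"
    unfolding m_def using assms(3) L_pos by (simp_all add: mult_left_mono)
  have "(\<lambda>n. (1 - s) ^ n * (L1 * L2)\<^sup>2) \<longlonglongrightarrow> 0 * (L1 * L2)\<^sup>2"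
    using s_pos s_less_1 by (intro tendsto_mult LIMSEQ_power_zero tendsto_const) auto
  then have "\<forall>\<^sub>F n in sequentially. (1 - s) ^ n * (L1 * L2)\<^sup>2 < s * m\<^sup>2"
    using s_pos m(1) by (intro order_tendstoD) auto
  then obtain n where n: "(1 - s) ^ n * (L1 * L2)\<^sup>2 < s * m\<^sup>2"
    by (auto simp: eventually_sequentially)
  obtain c d p q where cap: "captures t n c d p q" using captures_all_depths[OF t] by blast
  then obtain k l where I: "{c..d} \<in> F1 k" and J: "{p..q} \<in> F2 l"
    unfolding captures_def by blast
  define X where "X = (d - c) * L2"
  define Y where "Y = (q - p) * L1"
  have nonneg: "0 \<le> X" "0 \<le> Y"
    unfolding X_def Y_def using K1.bridge_Icc_less[OF I] K2.bridge_Icc_less[OF J] L_pos by simp_all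
  have bal: "s * X \<le> Y" "s * Y \<le> X" and small: "X * Y < s * m\<^sup>2"
    using cap n unfolding captures_def X_def Y_def by auto
  have "s * X\<^sup>2 \<le> X * Y" using mult_left_mono[OF bal(1) nonneg(1)] by (simp add: power2_eq_square mult_ac)
  then have "s * X\<^sup>2 < s * m\<^sup>2" using small by simp
  then have X: "X < m" using s_pos m(1) by (simp add: power2_less_imp_less)
  have "s * Y\<^sup>2 \<le> X * Y" using mult_right_mono[OF bal(2) nonneg(2)] by (simp add: power2_eq_square mult_ac)
  then have "s * Y\<^sup>2 < s * m\<^sup>2" using small by simp
  then have Y: "Y < m" using s_pos m(1) by (simp add: power2_less_imp_less)
  have "(d - c) * L2 < \<delta> * L2" "(q - p) * L1 < \<delta> * L1"
    using X Y m(2,3) unfolding X_def Y_def by linarith+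
  then have "d - c < \<delta>" "q - p < \<delta>" using L_pos by (simp_all add: mult_less_cancel_right)
  moreover have "f (c, p) \<le> t" "t \<le> f (d, q)" using cap unfolding captures_def by blast+
  ultimately show ?thesis using that I J by blast
qed

lemma continuous_f: "continuous_on S f"
proof -
  obtain f' :: "real \<times> real \<Rightarrow> (real \<times> real) \<Rightarrow>\<^sub>L real"
    where der: "\<And>z. (f has_derivative blinfun_apply (f' z)) (at z)"
    using C1 unfolding C1_def by blast
  show ?thesis
    by (intro continuous_at_imp_continuous_on ballI has_derivative_continuous[OF der])
qed

text \<open>Corners of rectangles of bridges lie in the product of the Cantor sets. Values of \<open>f\<close> there come
  arbitrarily close to \<open>t\<close> by uniform continuity, and the image is closed.\<close>

lemma image_cantor_sets:
  "f ` (cantor_set F1 \<times> cantor_set F2) = {f (A1, A2)..f (B1, B2)}"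
proof
  show "f ` (cantor_set F1 \<times> cantor_set F2) \<subseteq> {f (A1, A2)..f (B1, B2)}"
  proof clarify
    fix x y assume "x \<in> cantor_set F1" "y \<in> cantor_set F2"
    then have "x \<in> {A1..B1}" "y \<in> {A2..B2}"
      using K1.cantor_set_subset_hull K2.cantor_set_subset_hull by blast+
    then show "f (x, y) \<in> {f (A1, A2)..f (B1, B2)}" by (simp add: increasing)
  qed
next
  let ?K = "cantor_set F1 \<times> cantor_set F2"
  have "compact (f ` ?K)"
    by (intro compact_continuous_image continuous_f compact_Times
        K1.compact_cantor_set K2.compact_cantor_set)
  then have closed: "closed (f ` ?K)" by (rule compact_imp_closed)
  have unif: "uniformly_continuous_on ?K f"
    by (intro compact_uniformly_continuous continuous_f compact_Times
        K1.compact_cantor_set K2.compact_cantor_set)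
  show "{f (A1, A2)..f (B1, B2)} \<subseteq> f ` ?K"
  proof
    fix t assume "t \<in> {f (A1, A2)..f (B1, B2)}"
    then have t: "f (A1, A2) \<le> t" "t \<le> f (B1, B2)" by simp_all
    have "t \<in> closure (f ` ?K)"
      unfolding closure_approachable
    proof (intro allI impI)
      fix e :: real assume "0 < e"
      then obtain \<delta> where \<delta>: "0 < \<delta>"
          "\<And>z w. z \<in> ?K \<Longrightarrow> w \<in> ?K \<Longrightarrow> dist w z < \<delta> \<Longrightarrow> dist (f w) (f z) < e"
        using unif unfolding uniformly_continuous_on_def by meson
      obtain c d p q k l where *: "{c..d} \<in> F1 k" "{p..q} \<in> F2 l" "d - c < \<delta> / 2" "q - p < \<delta> / 2"
          "f (c, p) \<le> t" "t \<le> f (d, q)"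
        using captured_in_small_rectangle[OF t, of "\<delta> / 2"] \<delta>(1) by (metis half_gt_zero)
      have "c < d" "p < q" using * K1.bridge_Icc_less K2.bridge_Icc_less by blast+
      have corners: "(c, p) \<in> ?K" "(d, q) \<in> ?K"
        using K1.bridge_endpoints_in_cantor_set[OF *(1)] K2.bridge_endpoints_in_cantor_set[OF *(2)]
        by simp_all
      have "dist (d, q) (c, p) \<le> \<bar>d - c\<bar> + \<bar>q - p\<bar>"
        unfolding dist_Pair_Pair dist_real_def by (rule sqrt_sum_squares_le_sum_abs[THEN order_trans]) simp
      then have "dist (d, q) (c, p) < \<delta>" using * \<open>c < d\<close> \<open>p < q\<close> by simp
      then have "dist (f (d, q)) (f (c, p)) < e" using \<delta>(2) corners by blast
      then have "dist (f (c, p)) t < e" using *(5,6) by (simp add: dist_real_def)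
      then show "\<exists>y\<in>f ` ?K. dist y t < e" using corners(1) by blast
    qed
    then show "t \<in> f ` ?K" using closed by simp
  qed
qed

end

theorem corollary1p6:
  fixes f :: "real \<times> real \<Rightarrow> real"
    and A1 B1 A2 B2 :: real
    and F1 D1 F2 D2 :: "nat \<Rightarrow> real set set"
  assumes "C1 f"
    and "cantor_construction A1 B1 F1 D1"
    and "cantor_construction A2 B2 F2 D2"
    and "\<And>x y. x \<in> {A1..B1} \<Longrightarrow> y \<in> {A2..B2} \<Longrightarrow>
           partial_x f x y > 0 \<and> partial_y f x y > 0 \<and>
           s_min F1 F2 * (B2 - A2) * partial_y f x y
             - kappa F1 D1 F2 D2 * (B1 - A1) * partial_x f x y \<ge> 0 \<and>
           s_min F1 F2 * (B1 - A1) * partial_x f x y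
             - kappa F1 D1 F2 D2 * (B2 - A2) * partial_y f x y \<ge> 0 \<and>
           (B2 - A2) * partial_y f x y \<ge> partial_x f x y * Max (len ` D1 1) \<and>
           partial_x f x y * Min (len ` F1 1) \<ge> partial_y f x y * Max (len ` D2 1)"
  shows "\<exists>a b. a \<le> b \<and> f ` (cantor_set F1 \<times> cantor_set F2) = {a..b}"
proof -
  interpret cantor_pair A1 B1 F1 D1 A2 B2 F2 D2 f
    by (intro cantor_pair.intro cantor.intro cantor_pair_axioms.intro) (fact assms)+
  have "f (A1, A2) \<le> f (B1, B2)" using L_pos by (intro increasing) auto
  then show ?thesis using image_cantor_sets by blast
qed

end
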